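(* The system $(\mathcal{T}(\mathrm{P}\rtimes\mathbb{N}^{\times}),\mathbb{R},\sigma)$ has no $\mathrm{KMS}_\beta$ state for any $\beta\in(0,\infty)$ with $\beta<1$.
   Context: $\mathbb{N}^{\times}$ is the multiplicative semigroup of positive integers, and $\mathrm{P}=\{0,2,3,4,\dots\}$ is an additive semigroup. $\mathrm{P}\rtimes\mathbb{N}^{\times}$ is the semigroup of pairs $(m,a)$, $m\in \mathrm{P}$, $a\in\mathbb{N}^\times$, with product $(m,a)(n,b)=(m+an,ab)$ and unit $(0,1)$. For $(m,a),(n,b)\in\mathrm{P}\rtimes\mathbb{N}^{\times}$ put $(m,a)\Cup(n,b)=\infty$ if $(m+a\mathrm{P})\cap(n+b\mathrm{P})=\emptyset$, and otherwise $(m,a)\Cup(n,b)=(\ell,\mathrm{lcm}(a,b))$, where $\ell$ is the smallest element (usual order) of $(m+a\mathrm{P})\cap(n+b\mathrm{P})$. An isometric representation $W$ of $\mathrm{P}\rtimes\mathbb{N}^{\times}$ is a map into the isometries (on a Hilbert space, or in a unital $C^*$-algebra) with $W_{(0,1)}=1$ and $W_{xy}=W_xW_y$. It is covariant if $W_{(m,a)}W_{(m,a)}^*W_{(n,b)}W_{(n,b)}^*=W_{(m,a)\Cup(n,b)}W_{(m,a)\Cup(n,b)}^*$ for all $(m,a),(n,b)$, with the convention $W_\infty=0$. $\mathcal{T}(\mathrm{P}\rtimes\mathbb{N}^{\times})$ is the $C^*$-algebra generated by a covariant isometric representation $W:\mathrm{P}\rtimes\mathbb{N}^\times\to\mathcal{T}(\mathrm{P}\rtimes\mathbb{N}^{\times})$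 (the canonical one) that is universal: for every covariant isometric representation $X$ there is a homomorphism $\pi:\mathcal{T}(\mathrm{P}\rtimes\mathbb{N}^{\times})\to C^*(\{X_{(m,a)}\})$ with $\pi(W_{(m,a)})=X_{(m,a)}$. $\sigma$ is the strongly continuous action of $\mathbb{R}$ on $\mathcal{T}(\mathrm{P}\rtimes\mathbb{N}^{\times})$ with $\sigma_r(W_{(2,1)})=W_{(2,1)}$, $\sigma_r(W_{(3,1)})=W_{(3,1)}$, $\sigma_r(W_{(0,p)})=p^{ir}W_{(0,p)}$ for $p$ prime and $r\in\mathbb{R}$. An element $c$ is analytic for $\sigma$ if $r\mapsto\sigma_r(c)$ is the restriction to $\mathbb{R}$ of an entire function on $\mathbb{C}$, written $z\mapsto\sigma_z(c)$. For $\beta\in(0,\infty)$, a state $\phi$ is a $\mathrm{KMS}_\beta$ state for $\sigma$ if $\phi(cd)=\phi(d\,\sigma_{i\beta}(c))$ for all analytic elements $c,d$. *)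

theory Defs
  imports
    "HOL-Analysis.Analysis"
    "HOL-Algebra.Module"
    "HOL-Algebra.Algebraic_Closure_Type"
    "HOL-Computational_Algebra.Primes"
begin

section \<open>Unital C*-algebras\<close>

record 'a cstar = "(complex, 'a) module" +
  adj :: "'a \<Rightarrow> 'a"
  nrm :: "'a \<Rightarrow> real"

abbreviation complex_ring :: "complex ring"
  where "complex_ring \<equiv> ring_of_type_algebra"

text \<open>\<open>Metric_space\<close> requires nonnegativity and symmetry outside the carrier as well.\<close>

definition cdist :: "('a, 'm) cstar_scheme \<Rightarrow> 'a \<Rightarrow> 'a \<Rightarrow> real"
  where "cdist A x y = (if x \<in> carrier A \<and> y \<in> carrier A then nrm A (x \<ominus>\<^bsub>A\<^esub> y) else 0)"

abbreviation norm_topology :: "('a, 'm) cstar_scheme \<Rightarrow> 'a topology"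
  where "norm_topology A \<equiv> Metric_space.mtopology (carrier A) (cdist A)"

text \<open>
  The locale \<open>algebra\<close> of HOL-Algebra is restricted to commutative algebras, so the
  compatibility of scalars and products is stated here.  The zero algebra is not excluded.
\<close>

locale cstar_algebra = module complex_ring A + ring A
  for A :: "('a, 'm) cstar_scheme" (structure) +
  assumes smult_mult_left:
      "\<lbrakk>x \<in> carrier A; y \<in> carrier A\<rbrakk> \<Longrightarrow> (c \<odot> x) \<otimes> y = c \<odot> (x \<otimes> y)"
    and smult_mult_right:
      "\<lbrakk>x \<in> carrier A; y \<in> carrier A\<rbrakk> \<Longrightarrow> x \<otimes> (c \<odot> y) = c \<odot> (x \<otimes> y)"
    and adj_closed: "x \<in> carrier A \<Longrightarrow> adj A x \<in> carrier A"
    and adj_adj: "x \<in> carrier A \<Longrightarrow> adj A (adj A x) = x"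
    and adj_add:
      "\<lbrakk>x \<in> carrier A; y \<in> carrier A\<rbrakk> \<Longrightarrow> adj A (x \<oplus> y) = adj A x \<oplus> adj A y"
    and adj_mult:
      "\<lbrakk>x \<in> carrier A; y \<in> carrier A\<rbrakk> \<Longrightarrow> adj A (x \<otimes> y) = adj A y \<otimes> adj A x"
    and adj_smult: "x \<in> carrier A \<Longrightarrow> adj A (c \<odot> x) = cnj c \<odot> adj A x"
    and nrm_nonneg: "x \<in> carrier A \<Longrightarrow> 0 \<le> nrm A x"
    and nrm_eq_0_iff: "x \<in> carrier A \<Longrightarrow> nrm A x = 0 \<longleftrightarrow> x = \<zero>"
    and nrm_triangle:
      "\<lbrakk>x \<in> carrier A; y \<in> carrier A\<rbrakk> \<Longrightarrow> nrm A (x \<oplus> y) \<le> nrm A x + nrm A y"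
    and nrm_smult: "x \<in> carrier A \<Longrightarrow> nrm A (c \<odot> x) = cmod c * nrm A x"
    and nrm_mult:
      "\<lbrakk>x \<in> carrier A; y \<in> carrier A\<rbrakk> \<Longrightarrow> nrm A (x \<otimes> y) \<le> nrm A x * nrm A y"
    and cstar_identity: "x \<in> carrier A \<Longrightarrow> nrm A (adj A x \<otimes> x) = (nrm A x)\<^sup>2"
    and complete: "Metric_space.mcomplete (carrier A) (cdist A)"

lemma (in cstar_algebra) Metric_space_cdist: "Metric_space (carrier A) (cdist A)"
proof
  have minus: "nrm A (\<ominus> x) = nrm A x" if x: "x \<in> carrier A" for x
  proof -
    have "((1 - 1) :: complex) \<odot> x = \<zero>"
      using nrm_smult[OF x, of 0] nrm_eq_0_iff[of "0 \<odot> x"] smult_closed[of 0 x] x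
      by (simp add: ring_of_type_algebra_def)
    moreover have "(1 + (-1) :: complex) \<odot> x = 1 \<odot> x \<oplus> (-1) \<odot> x"
      using smult_l_distr[of 1 "-1" x] x by (simp add: ring_of_type_algebra_def)
    moreover have "1 \<odot> x = x" and c: "(-1) \<odot> x \<in> carrier A"
      using smult_one[OF x] smult_closed[of "-1" x] x by (simp_all add: ring_of_type_algebra_def)
    ultimately have "\<ominus> x = (-1) \<odot> x"
      using x by (metis minus_equality a_comm add.right_neutral diff_conv_add_uminus)
    then show ?thesis
      using nrm_smult[OF x, of "-1"] by simp
  qed
  show "0 \<le> cdist A x y" for x y
    by (simp add: cdist_def nrm_nonneg)
  show "cdist A x y = cdist A y x" for x y
  proof (cases "x \<in> carrier A \<and> y \<in> carrier A")
    case True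
    then have "x \<ominus> y = \<ominus> (y \<ominus> x)"
      by (simp add: minus_eq minus_add a_comm)
    then show ?thesis
      using True minus[of "y \<ominus> x"] by (simp add: cdist_def)
  qed (auto simp: cdist_def)
  show "cdist A x y = 0 \<longleftrightarrow> x = y" if "x \<in> carrier A" "y \<in> carrier A" for x y
    using that by (simp add: cdist_def nrm_eq_0_iff)
  show "cdist A x z \<le> cdist A x y + cdist A y z"
    if "x \<in> carrier A" "y \<in> carrier A" "z \<in> carrier A" for x y z
  proof -
    have "x \<ominus> z = (x \<ominus> y) \<oplus> (y \<ominus> z)"
      using that by (simp add: minus_eq a_assoc r_neg1)
    then show ?thesis
      using that nrm_triangle[of "x \<ominus> y" "y \<ominus> z"] by (simp add: cdist_def)
  qed
qed

definition cstar_subalgebra :: "('a, 'm) cstar_scheme \<Rightarrow> 'a set \<Rightarrow> bool"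
  where "cstar_subalgebra A S \<longleftrightarrow>
     submodule S complex_ring A \<and>
     (\<forall>x\<in>S. \<forall>y\<in>S. x \<otimes>\<^bsub>A\<^esub> y \<in> S) \<and>
     (\<forall>x\<in>S. adj A x \<in> S) \<and>
     closedin (norm_topology A) S"

definition cstar_generated :: "('a, 'm) cstar_scheme \<Rightarrow> 'a set \<Rightarrow> 'a set"
  where "cstar_generated A G = cstar_subalgebra A hull G"

definition star_hom :: "('a, 'm) cstar_scheme \<Rightarrow> ('b, 'n) cstar_scheme \<Rightarrow> ('a \<Rightarrow> 'b) set"
  where "star_hom A B = {h \<in> ring_hom A B.
     (\<forall>c. \<forall>x\<in>carrier A. h (c \<odot>\<^bsub>A\<^esub> x) = c \<odot>\<^bsub>B\<^esub> h x) \<and>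
     (\<forall>x\<in>carrier A. h (adj A x) = adj B (h x))}"

section \<open>The semigroup and its covariant isometric representations\<close>

definition semP :: "nat set"
  where "semP = {0} \<union> {2..}"

definition PN :: "(nat \<times> nat) monoid"
  where "PN = \<lparr>carrier = semP \<times> {0<..},
     monoid.mult = (\<lambda>(m, a) (n, b). (m + a * n, a * b)), one = (0, 1)\<rparr>"

definition translate :: "nat \<times> nat \<Rightarrow> nat set"
  where "translate = (\<lambda>(m, a). (\<lambda>k. m + a * k) ` semP)"

text \<open>The value \<open>None\<close> stands for \<open>\<infinity>\<close>.\<close>

definition cup :: "nat \<times> nat \<Rightarrow> nat \<times> nat \<Rightarrow> (nat \<times> nat) option"
  where "cup x y =
     (if translate x \<inter> translate y = {} then None
      else Some (LEAST l. l \<in> translate x \<inter> translate y, lcm (snd x) (snd y)))"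

definition isometric_rep :: "('a, 'm) cstar_scheme \<Rightarrow> (nat \<times> nat \<Rightarrow> 'a) \<Rightarrow> bool"
  where "isometric_rep A W \<longleftrightarrow>
     (\<forall>x\<in>carrier PN. W x \<in> carrier A \<and> adj A (W x) \<otimes>\<^bsub>A\<^esub> W x = \<one>\<^bsub>A\<^esub>) \<and>
     W \<one>\<^bsub>PN\<^esub> = \<one>\<^bsub>A\<^esub> \<and>
     (\<forall>x\<in>carrier PN. \<forall>y\<in>carrier PN. W (x \<otimes>\<^bsub>PN\<^esub> y) = W x \<otimes>\<^bsub>A\<^esub> W y)"

definition range_proj :: "('a, 'm) cstar_scheme \<Rightarrow> (nat \<times> nat \<Rightarrow> 'a) \<Rightarrow> nat \<times> nat \<Rightarrow> 'a"
  where "range_proj A W x = W x \<otimes>\<^bsub>A\<^esub> adj A (W x)"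

definition covariant_rep :: "('a, 'm) cstar_scheme \<Rightarrow> (nat \<times> nat \<Rightarrow> 'a) \<Rightarrow> bool"
  where "covariant_rep A W \<longleftrightarrow> isometric_rep A W \<and>
     (\<forall>x\<in>carrier PN. \<forall>y\<in>carrier PN.
        range_proj A W x \<otimes>\<^bsub>A\<^esub> range_proj A W y =
          (case cup x y of None \<Rightarrow> \<zero>\<^bsub>A\<^esub> | Some z \<Rightarrow> range_proj A W z))"

section \<open>The Toeplitz algebra, its dynamics and KMS states\<close>

text \<open>
  \<open>T\<close>, with canonical representation \<open>W\<close>, is a model of the Toeplitz algebra of \<open>PN\<close>.
  HOL cannot quantify over the types carrying the target algebras; they range over all
  unital C*-algebras carried by a set of reals.  Nothing is lost: only the C*-subalgebra
  generated by \<open>V\<close> matters, and since \<open>PN\<close> is countable this algebra is separable, has at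
  most continuum many elements, and so has an isomorphic copy carried by a set of reals.
  In particular the universal property determines \<open>(T, W)\<close> up to isomorphism.
\<close>

definition toeplitz_algebra :: "('a, 'm) cstar_scheme \<Rightarrow> (nat \<times> nat \<Rightarrow> 'a) \<Rightarrow> bool"
  where "toeplitz_algebra T W \<longleftrightarrow>
     cstar_algebra T \<and>
     covariant_rep T W \<and>
     cstar_generated T (W ` carrier PN) = carrier T \<and>
     (\<forall>(B :: real cstar) V. cstar_algebra B \<and> covariant_rep B V \<longrightarrow>
        (\<exists>\<pi>\<in>star_hom T B.
           \<pi> ` carrier T \<subseteq> cstar_generated B (V ` carrier PN) \<and>
           (\<forall>x\<in>carrier PN. \<pi> (W x) = V x)))"

text \<open>Bijectivity of each \<open>\<sigma> r\<close> follows from the group law.\<close>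

definition cstar_action :: "('a, 'm) cstar_scheme \<Rightarrow> (real \<Rightarrow> 'a \<Rightarrow> 'a) \<Rightarrow> bool"
  where "cstar_action A \<sigma> \<longleftrightarrow>
     (\<forall>r. \<sigma> r \<in> star_hom A A) \<and>
     (\<forall>x\<in>carrier A. \<sigma> 0 x = x) \<and>
     (\<forall>r s. \<forall>x\<in>carrier A. \<sigma> (r + s) x = \<sigma> r (\<sigma> s x)) \<and>
     (\<forall>x\<in>carrier A. continuous_map euclideanreal (norm_topology A) (\<lambda>r. \<sigma> r x))"

definition toeplitz_dynamics ::
    "('a, 'm) cstar_scheme \<Rightarrow> (nat \<times> nat \<Rightarrow> 'a) \<Rightarrow> (real \<Rightarrow> 'a \<Rightarrow> 'a) \<Rightarrow> bool"
  where "toeplitz_dynamics T W \<sigma> \<longleftrightarrow>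
     cstar_action T \<sigma> \<and>
     (\<forall>r. \<sigma> r (W (2, 1)) = W (2, 1)) \<and>
     (\<forall>r. \<sigma> r (W (3, 1)) = W (3, 1)) \<and>
     (\<forall>r. \<forall>p :: nat. Factorial_Ring.prime p \<longrightarrow>
        \<sigma> r (W (0, p)) = (of_nat p powr (\<i> * of_real r)) \<odot>\<^bsub>T\<^esub> W (0, p))"

definition entire :: "('a, 'm) cstar_scheme \<Rightarrow> (complex \<Rightarrow> 'a) \<Rightarrow> bool"
  where "entire A F \<longleftrightarrow> (\<forall>z. F z \<in> carrier A) \<and>
     (\<forall>z. \<exists>D. limitin (norm_topology A)
        (\<lambda>h. (1 / h) \<odot>\<^bsub>A\<^esub> (F (z + h) \<ominus>\<^bsub>A\<^esub> F z)) D (at 0))"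

definition entire_extension ::
    "('a, 'm) cstar_scheme \<Rightarrow> (real \<Rightarrow> 'a \<Rightarrow> 'a) \<Rightarrow> 'a \<Rightarrow> (complex \<Rightarrow> 'a) \<Rightarrow> bool"
  where "entire_extension A \<sigma> c F \<longleftrightarrow> entire A F \<and> (\<forall>r. F (of_real r) = \<sigma> r c)"

definition analytic_element :: "('a, 'm) cstar_scheme \<Rightarrow> (real \<Rightarrow> 'a \<Rightarrow> 'a) \<Rightarrow> 'a \<Rightarrow> bool"
  where "analytic_element A \<sigma> c \<longleftrightarrow> c \<in> carrier A \<and> (\<exists>F. entire_extension A \<sigma> c F)"

definition state :: "('a, 'm) cstar_scheme \<Rightarrow> ('a \<Rightarrow> complex) \<Rightarrow> bool"
  where "state A \<phi> \<longleftrightarrow>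
     (\<forall>x\<in>carrier A. \<forall>y\<in>carrier A. \<phi> (x \<oplus>\<^bsub>A\<^esub> y) = \<phi> x + \<phi> y) \<and>
     (\<forall>c. \<forall>x\<in>carrier A. \<phi> (c \<odot>\<^bsub>A\<^esub> x) = c * \<phi> x) \<and>
     (\<forall>x\<in>carrier A. \<phi> (adj A x \<otimes>\<^bsub>A\<^esub> x) \<in> \<real>\<^sub>\<ge>\<^sub>0) \<and>
     \<phi> \<one>\<^bsub>A\<^esub> = 1"

text \<open>
  Entire extensions are unique by the identity theorem, so \<open>F (\<i> * \<beta>)\<close> below is
  the element usually written \<open>\<sigma>\<^bsub>i\<beta>\<^esub>(c)\<close>.
\<close>

definition kms_state ::
    "('a, 'm) cstar_scheme \<Rightarrow> (real \<Rightarrow> 'a \<Rightarrow> 'a) \<Rightarrow> real \<Rightarrow> ('a \<Rightarrow> complex) \<Rightarrow> bool"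
  where "kms_state A \<sigma> \<beta> \<phi> \<longleftrightarrow> state A \<phi> \<and>
     (\<forall>c d F. analytic_element A \<sigma> c \<longrightarrow> analytic_element A \<sigma> d \<longrightarrow>
        entire_extension A \<sigma> c F \<longrightarrow>
        \<phi> (c \<otimes>\<^bsub>A\<^esub> d) = \<phi> (d \<otimes>\<^bsub>A\<^esub> F (\<i> * of_real \<beta>)))"

end

theory Submission
  imports Defs
begin

text \<open>
  The obstruction is that two orthogonal isometries are scaled too little by the dynamics.
  If \<open>u\<close> is an isometry with \<open>\<sigma>\<^sub>r(u) = n\<^bsup>ir\<^esup> u\<close>, the KMS condition moves \<open>u\<close> past \<open>u\<^sup>*\<close> at the cost
  of a factor \<open>n\<^bsup>-\<beta>\<^esup>\<close>, so a KMS state \<open>\<phi>\<close> satisfies \<open>\<phi>(u u\<^sup>*) = n\<^bsup>-\<beta>\<^esup> \<phi>(u\<^sup>* u) = n\<^bsup>-\<beta>\<^esup>\<close>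
  (\<open>kms_range_projection\<close>).  Both \<open>W (0, 2)\<close> and \<open>W (3, 2) = W (3, 1) W (0, 2)\<close> are isometries
  scaled by \<open>2\<^bsup>ir\<^esup>\<close>.  The set \<open>0 + 2P\<close> consists of even and \<open>3 + 2P\<close> of odd numbers; they are
  disjoint, so by covariance the two range projections are orthogonal.  Their sum is a projection,
  on which a state takes a value at most \<open>1\<close> (\<open>state_projection_le_one\<close>).  Hence
  \<open>2 \<cdot> 2\<^bsup>-\<beta>\<^esup> \<le> 1\<close>, that is, \<open>\<beta> \<ge> 1\<close>.

  The residue class of \<open>1\<close> modulo \<open>2\<close> has to be represented by \<open>3\<close>, since \<open>1\<close> is not in \<open>P\<close>.
\<close>

context cstar_algebra
begin

lemma adj_one: "adj A \<one> = \<one>"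
proof -
  have "adj A (adj A \<one> \<otimes> \<one>) = adj A \<one> \<otimes> \<one>"
    by (metis adj_adj adj_closed adj_mult one_closed)
  then show ?thesis
    by (simp add: adj_adj adj_closed)
qed

lemma adj_minus:
  assumes "x \<in> carrier A" "y \<in> carrier A"
  shows "adj A (x \<ominus> y) = adj A x \<ominus> adj A y"
proof -
  have "adj A (x \<ominus> y) \<oplus> adj A y = adj A x"
    using assms by (simp flip: adj_add add: minus_eq a_assoc l_neg)
  then show ?thesis
    using assms
    by (metis adj_closed minus_closed minus_eq a_assoc r_neg r_zero a_inv_closed)
qed

lemma smult_minus_distr:
  assumes "x \<in> carrier A"
  shows "c \<odot> x \<ominus> d \<odot> x = (c - d) \<odot> x"
proof -
  have "(c - d) \<odot> x \<oplus> d \<odot> x = c \<odot> x"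
    using smult_l_distr[of "c - d" d x] assms by (simp add: ring_of_type_algebra_def)
  moreover have "(c - d) \<odot> x \<in> carrier A" "d \<odot> x \<in> carrier A"
    using assms smult_closed by (simp_all add: ring_of_type_algebra_def)
  ultimately show ?thesis
    by (metis minus_eq a_assoc r_neg r_zero a_inv_closed)
qed

lemma smult_in_carrier: "x \<in> carrier A \<Longrightarrow> c \<odot> x \<in> carrier A"
  using smult_closed[of c x] by (simp add: ring_of_type_algebra_def)

lemma smult_smult: "x \<in> carrier A \<Longrightarrow> c \<odot> (d \<odot> x) = (c * d) \<odot> x"
  using smult_assoc1[of c d x] by (simp add: ring_of_type_algebra_def)

text \<open>
  The difference quotients of \<open>\<lambda>z. f z \<odot> u\<close> are those of \<open>f\<close> applied to \<open>u\<close>, and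
  \<open>c \<mapsto> c \<odot> u\<close> multiplies distances by the norm of \<open>u\<close>.
\<close>

lemma entire_smult:
  assumes u: "u \<in> carrier A"
    and f: "\<And>z. (f has_field_derivative f' z) (at z)"
  shows "entire A (\<lambda>z. f z \<odot> u)"
  unfolding entire_def
proof (intro conjI allI exI)
  fix z
  show "f z \<odot> u \<in> carrier A"
    using u by (rule smult_in_carrier)
  interpret Metric_space "carrier A" "cdist A"
    by (rule Metric_space_cdist)
  define q where "q h = (f (z + h) - f z) / h" for h
  have quot: "(1 / h) \<odot> (f (z + h) \<odot> u \<ominus> f z \<odot> u) = q h \<odot> u" for h
    using u by (simp add: smult_minus_distr smult_smult q_def)
  have dist: "cdist A (c \<odot> u) (d \<odot> u) = cmod (c - d) * nrm A u" for c d
    using u by (simp add: cdist_def smult_in_carrier smult_minus_distr nrm_smult)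
  have "q \<midarrow>0\<rightarrow> f' z"
    using f[of z] by (simp add: DERIV_def q_def[abs_def])
  then have "((\<lambda>h. cmod (q h - f' z) * nrm A u) \<longlongrightarrow> 0) (at 0)"
    by (intro tendsto_mult_left_zero tendsto_norm_zero) (simp add: LIM_zero)
  then have "\<forall>\<^sub>F h in at 0. cmod (q h - f' z) * nrm A u < \<epsilon>" if "\<epsilon> > 0" for \<epsilon>
    using that by (simp add: order_tendsto_iff)
  then show "limitin (norm_topology A)
      (\<lambda>h. (1 / h) \<odot> (f (z + h) \<odot> u \<ominus> f z \<odot> u)) (f' z \<odot> u) (at 0)"
    using u by (simp add: limitin_metric quot dist smult_in_carrier)
qed

text \<open>The complement \<open>\<one> \<ominus> e\<close> of a projection is again one, hence of the form \<open>x\<^sup>* x\<close>.\<close>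

lemma state_projection_le_one:
  assumes \<phi>: "state A \<phi>"
    and e: "e \<in> carrier A" "adj A e = e" "e \<otimes> e = e"
  shows "Re (\<phi> e) \<le> 1"
proof -
  let ?x = "\<one> \<ominus> e"
  have x: "?x \<in> carrier A"
    using e by simp
  have "?x \<otimes> ?x = ?x"
    using e by (simp add: minus_eq l_distr r_distr r_minus l_minus r_neg l_neg a_assoc)
  then have "adj A ?x \<otimes> ?x = ?x"
    using e by (simp add: adj_minus adj_one)
  then have "\<phi> ?x \<in> \<real>\<^sub>\<ge>\<^sub>0"
    using \<phi> x unfolding state_def by metis
  moreover have "\<phi> ?x + \<phi> e = 1"
  proof -
    have "?x \<oplus> e = \<one>"
      using e by (simp add: minus_eq a_assoc l_neg)
    then show ?thesis
      using \<phi> x e unfolding state_def by metis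
  qed
  ultimately show ?thesis
    by (metis Re_complex_of_real complex_nonneg_Reals_iff le_add_same_cancel2 one_complex.sel(1)
        plus_complex.sel(1))
qed

text \<open>
  The KMS condition is applied to \<open>u\<close> and \<open>u\<^sup>*\<close>.  The entire extensions are explicit because both
  are eigenvectors of \<open>\<sigma>\<close>, and \<open>n\<^bsup>iz\<^esup>\<close> takes the value \<open>n\<^bsup>-\<beta>\<^esup>\<close> at \<open>z = i\<beta>\<close>.
\<close>

lemma kms_range_projection:
  fixes n :: nat and \<sigma> :: "real \<Rightarrow> 'a \<Rightarrow> 'a"
  assumes \<sigma>: "cstar_action A \<sigma>" and kms: "kms_state A \<sigma> \<beta> \<phi>"
    and u: "u \<in> carrier A" "adj A u \<otimes> u = \<one>"
    and n: "0 < n"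
    and eigen: "\<And>r. \<sigma> r u = (of_nat n powr (\<i> * of_real r)) \<odot> u"
  shows "\<phi> (u \<otimes> adj A u) = of_real (real n powr - \<beta>)"
proof -
  have u': "adj A u \<in> carrier A"
    using u by (simp add: adj_closed)
  let ?F = "\<lambda>z. (of_nat n powr (\<i> * z)) \<odot> u"
  let ?G = "\<lambda>z. (of_nat n powr (- \<i> * z)) \<odot> adj A u"
  have deriv: "((\<lambda>z. of_nat n powr (c * z)) has_field_derivative
      c * Ln (of_nat n) * of_nat n powr (c * z)) (at z)" for c z :: complex
    using n by (auto simp: powr_def intro!: derivative_eq_intros)
  have F: "entire_extension A \<sigma> u ?F"
    using entire_smult[OF u(1) deriv] eigen by (simp add: entire_extension_def)
  have "\<sigma> r (adj A u) = ?G (of_real r)" for r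
  proof -
    have "\<sigma> r (adj A u) = adj A (\<sigma> r u)"
      using \<sigma> u by (simp add: cstar_action_def star_hom_def)
    also have "\<dots> = cnj (of_nat n powr (\<i> * of_real r)) \<odot> adj A u"
      using u eigen by (simp add: adj_smult)
    also have "cnj (of_nat n powr (\<i> * of_real r)) = of_nat n powr (- \<i> * of_real r)"
      using n by (simp add: powr_def exp_cnj)
    finally show ?thesis .
  qed
  then have G: "entire_extension A \<sigma> (adj A u) ?G"
    using entire_smult[OF u' deriv[of "- \<i>"]] by (simp add: entire_extension_def)
  have "\<phi> (u \<otimes> adj A u) = \<phi> (adj A u \<otimes> ?F (\<i> * of_real \<beta>))"
    using kms F G u u' unfolding kms_state_def analytic_element_def by blast
  also have "\<i> * (\<i> * complex_of_real \<beta>) = of_real (- \<beta>)"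
    by simp
  also have "of_nat n powr complex_of_real (- \<beta>) = of_real (real n powr - \<beta>)"
    using powr_of_real[of "real n" "- \<beta>"] by simp
  also have "\<phi> (adj A u \<otimes> (of_real (real n powr - \<beta>) \<odot> u)) = of_real (real n powr - \<beta>)"
    using kms u u' by (simp add: smult_mult_right kms_state_def state_def)
  finally show ?thesis .
qed

lemma range_projection_of_isometry:
  assumes "u \<in> carrier A" "adj A u \<otimes> u = \<one>"
  shows "u \<otimes> adj A u \<in> carrier A"
    and "adj A (u \<otimes> adj A u) = u \<otimes> adj A u"
    and "(u \<otimes> adj A u) \<otimes> (u \<otimes> adj A u) = u \<otimes> adj A u"
proof -
  have u': "adj A u \<in> carrier A"
    using assms by (simp add: adj_closed)
  show "u \<otimes> adj A u \<in> carrier A" "adj A (u \<otimes> adj A u) = u \<otimes> adj A u"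
    using assms u' by (simp_all add: adj_mult adj_adj)
  have "(u \<otimes> adj A u) \<otimes> (u \<otimes> adj A u) = u \<otimes> (adj A u \<otimes> u) \<otimes> adj A u"
    using assms(1) u' by (simp add: m_assoc)
  then show "(u \<otimes> adj A u) \<otimes> (u \<otimes> adj A u) = u \<otimes> adj A u"
    using assms u' by simp
qed

lemma sum_of_orthogonal_projections:
  assumes p: "p \<in> carrier A" "adj A p = p" "p \<otimes> p = p"
    and q: "q \<in> carrier A" "adj A q = q" "q \<otimes> q = q"
    and pq: "p \<otimes> q = \<zero>"
  shows "adj A (p \<oplus> q) = p \<oplus> q" "(p \<oplus> q) \<otimes> (p \<oplus> q) = p \<oplus> q"
proof -
  have "adj A \<zero> = \<zero>"
    using adj_minus[of \<one> \<one>] by (simp add: adj_one minus_eq r_neg)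
  then have "q \<otimes> p = \<zero>"
    using adj_mult[of p q] p q pq by simp
  then show "adj A (p \<oplus> q) = p \<oplus> q" "(p \<oplus> q) \<otimes> (p \<oplus> q) = p \<oplus> q"
    using p q pq by (simp_all add: adj_add l_distr r_distr)
qed

end

lemma cup_even_odd: "cup (0, 2) (3, 2) = None"
proof -
  have "2 * k \<noteq> 3 + 2 * l" for k l :: nat
    by presburger
  then show ?thesis
    by (auto simp: cup_def translate_def)
qed

theorem theorem4p2:
  fixes T :: "'a cstar" and W :: "nat \<times> nat \<Rightarrow> 'a"
    and \<sigma> :: "real \<Rightarrow> 'a \<Rightarrow> 'a" and \<beta> :: real
  assumes "toeplitz_algebra T W"
    and "toeplitz_dynamics T W \<sigma>"
    and "0 < \<beta>" and "\<beta> < 1"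
  shows "\<not> (\<exists>\<phi>. kms_state T \<sigma> \<beta> \<phi>)"
proof
  assume "\<exists>\<phi>. kms_state T \<sigma> \<beta> \<phi>"
  then obtain \<phi> where kms: "kms_state T \<sigma> \<beta> \<phi>" ..
  then have \<phi>: "state T \<phi>"
    by (simp add: kms_state_def)
  interpret cstar_algebra T
    using assms(1) by (simp add: toeplitz_algebra_def)
  have cov: "covariant_rep T W" and \<sigma>: "cstar_action T \<sigma>"
    using assms(1,2) by (simp_all add: toeplitz_algebra_def toeplitz_dynamics_def)
  then have iso: "isometric_rep T W"
    by (simp add: covariant_rep_def)
  have PN: "(0, 2) \<in> carrier PN" "(3, 1) \<in> carrier PN" "(3, 2) \<in> carrier PN"
    by (auto simp: PN_def semP_def)
  let ?u = "W (0, 2)" and ?s = "W (3, 1)" and ?v = "W (3, 2)"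
  have u: "?u \<in> carrier T" "adj T ?u \<otimes>\<^bsub>T\<^esub> ?u = \<one>\<^bsub>T\<^esub>"
    and v: "?v \<in> carrier T" "adj T ?v \<otimes>\<^bsub>T\<^esub> ?v = \<one>\<^bsub>T\<^esub>"
    and s: "?s \<in> carrier T"
    using iso PN by (auto simp: isometric_rep_def)
  have "(3, 1) \<otimes>\<^bsub>PN\<^esub> (0, 2) = (3, 2)"
    by (simp add: PN_def)
  then have v_eq: "?v = ?s \<otimes>\<^bsub>T\<^esub> ?u"
    using iso PN unfolding isometric_rep_def by metis
  have \<sigma>_u: "\<sigma> r ?u = (of_nat 2 powr (\<i> * of_real r)) \<odot>\<^bsub>T\<^esub> ?u" for r
    using assms(2) two_is_prime_nat unfolding toeplitz_dynamics_def by blast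
  have \<sigma>_v: "\<sigma> r ?v = (of_nat 2 powr (\<i> * of_real r)) \<odot>\<^bsub>T\<^esub> ?v" for r
  proof -
    have "\<sigma> r \<in> ring_hom T T" "\<sigma> r ?s = ?s"
      using \<sigma> assms(2) by (simp_all add: cstar_action_def star_hom_def toeplitz_dynamics_def)
    then have "\<sigma> r ?v = ?s \<otimes>\<^bsub>T\<^esub> \<sigma> r ?u"
      using s u by (simp add: v_eq ring_hom_mult)
    then show ?thesis
      using s u by (simp add: \<sigma>_u v_eq smult_mult_right)
  qed
  let ?p = "?u \<otimes>\<^bsub>T\<^esub> adj T ?u" and ?q = "?v \<otimes>\<^bsub>T\<^esub> adj T ?v"
  note p = range_projection_of_isometry[OF u] and q = range_projection_of_isometry[OF v]
  have "range_proj T W (0, 2) \<otimes>\<^bsub>T\<^esub> range_proj T W (3, 2) = \<zero>\<^bsub>T\<^esub>"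
    using cov PN cup_even_odd unfolding covariant_rep_def by (metis option.case(1))
  then have "?p \<otimes>\<^bsub>T\<^esub> ?q = \<zero>\<^bsub>T\<^esub>"
    by (simp add: range_proj_def)
  note e = sum_of_orthogonal_projections[OF p q this]
  have "\<phi> ?p = of_real (2 powr - \<beta>)" "\<phi> ?q = of_real (2 powr - \<beta>)"
    using kms_range_projection[OF \<sigma> kms u _ \<sigma>_u] kms_range_projection[OF \<sigma> kms v _ \<sigma>_v]
    by simp_all
  then have "\<phi> (?p \<oplus>\<^bsub>T\<^esub> ?q) = of_real (2 * 2 powr - \<beta>)"
    using \<phi> p q by (simp add: state_def)
  then have "2 * 2 powr - \<beta> \<le> 1"
    using state_projection_le_one[OF \<phi> _ e] p q by simp
  moreover have "2 * 2 powr - \<beta> = 2 powr (1 - \<beta>)"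
    by (simp add: powr_diff powr_minus divide_inverse)
  moreover have "2 powr (1 - \<beta>) > 1"
    using assms(4) by simp
  ultimately show False
    by simp
qed

end
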